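(* Let $G=(V,E)$ be a connected simple graph (possibly infinite) with at least two vertices. Then the following are equivalent: (i) $\pi(G)=[-1,1]$. (ii) $G$ is isometrically embeddable into a hypercube, i.e., there exist a nonempty (possibly infinite) set $\Sigma$ and a map $\theta$ from $V$ to the vertex set of the hypercube $\mathcal{Q}_{\Sigma}$ such that the distance between $\theta(x)$ and $\theta(y)$ in $\mathcal{Q}_{\Sigma}$ equals $\partial(x,y)$ for all $x,y\in V$. (iii) $G$ is bipartite and has no quintuple $(x_1,x_2,x_3,x_4,x_5)$ of vertices such that $x_1\sim x_2$, $x_3\sim x_4$, $x_3\in G(x_1,x_2)$, $x_4\in G(x_2,x_1)$, and $x_5\in G(x_1,x_2)\cap G(x_4,x_3)$. (iv) $G$ is bipartite, and $G(x,y)$ is convex for any adjacent vertices $x$ and $y$; i.e., every geodesic of $G$ between two vertices of $G(x,y)$ is entirely contained in $G(x,y)$.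
   Context: Graphs may be finite or infinite, and are not assumed to be locally finite. For a connected simple graph $G=(V,E)$, let $\partial(x,y)$ denote the path-length distance between $x,y\in V$, and write $x\sim y$ if $x$ and $y$ are adjacent. A geodesic between two vertices is a shortest path between them. For $q\in\mathbb{R}$, the $Q$-matrix of $G$ is $Q_q=(q^{\partial(x,y)})_{x,y\in V}$, where $0^0:=1$. We say $Q_q$ is positive semidefinite, written $Q_q\succcurlyeq 0$, if $\sum_{x,y\in V}\overline{f(x)}f(y)\,q^{\partial(x,y)}\geqslant 0$ for every finitely supported function $f:V\rightarrow\mathbb{C}$. Define $\pi(G)=\{q\in\mathbb{R}:Q_q\succcurlyeq 0\}$. For two adjacent vertices $x$ and $y$ of $G$, let $G(x,y)=\{z\in V:\partial(z,x)=\partial(z,y)-1\}$. For a nonempty set $\Sigma$ (finite or infinite), the hypercube $\mathcal{Q}_{\Sigma}$ is the graph whose vertices are the finite subsets of $\Sigma$, where two vertices are adjacent if and only if one of them is obtained from the other by removing one element. The distance between two vertices of $\mathcal{Q}_{\Sigma}$ equals the size of their symmetric difference. *)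

theory Defs
  imports
    "HOL-Library.Nonpos_Ints"
    "Graph_Theory.Digraph_Component"
    "Graph_Theory.Shortest_Path"
begin

text \<open>
  Simple graphs are symmetric loopfree digraphs whose arcs are pairs of vertices
  (\<^locale>\<open>pair_bidirected_digraph\<close>). Vertex sets and degrees may be infinite.
\<close>

(* The value is meaningful only if v is reachable from u. *)
definition gdist :: "'a pair_pre_digraph \<Rightarrow> 'a \<Rightarrow> 'a \<Rightarrow> nat" where
  "gdist G u v = (LEAST n. \<exists>p. pre_digraph.awalk (with_proj G) u p v \<and> length p = n)"

lemma (in pair_wf_digraph) gdist_eq_mu:
  assumes "u \<rightarrow>\<^sup>*\<^bsub>with_proj G\<^esub> v"
  shows "ereal (real (gdist G u v)) = \<mu> (\<lambda>_. 1) u v"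
proof (rule antisym)
  have cost: "awalk_cost (\<lambda>_. 1) p = real (length p)" for p
    by (induction p) auto
  obtain p0 where "awalk u p0 v"
    using assms reachable_awalk by auto
  then have "\<exists>n p. awalk u p v \<and> length p = n" by blast
  then have "\<exists>p. awalk u p v \<and> length p = gdist G u v"
    unfolding gdist_def by (rule LeastI_ex)
  then show "\<mu> (\<lambda>_. 1) u v \<le> ereal (real (gdist G u v))"
    using min_cost_le_walk_cost[of u _ v "\<lambda>_. 1"] cost by metis
  show "ereal (real (gdist G u v)) \<le> \<mu> (\<lambda>_. 1) u v"
    unfolding \<mu>_def cost gdist_def by (auto intro!: INF_greatest Least_le)
qed

definition geodesic :: "'a pair_pre_digraph \<Rightarrow> 'a \<Rightarrow> ('a \<times> 'a) awalk \<Rightarrow> 'a \<Rightarrow> bool" where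
  "geodesic G u p v \<longleftrightarrow> pre_digraph.apath (with_proj G) u p v \<and> length p = gdist G u v"

definition geodesically_convex :: "'a pair_pre_digraph \<Rightarrow> 'a set \<Rightarrow> bool" where
  "geodesically_convex G S \<longleftrightarrow>
    (\<forall>u\<in>S. \<forall>v\<in>S. \<forall>p. geodesic G u p v \<longrightarrow> set (pre_digraph.awalk_verts (with_proj G) u p) \<subseteq> S)"

(* The equation is over int, since subtraction on nat truncates. *)
definition closer :: "'a pair_pre_digraph \<Rightarrow> 'a \<Rightarrow> 'a \<Rightarrow> 'a set" where
  "closer G x y = {z \<in> pverts G. int (gdist G z x) = int (gdist G z y) - 1}"

definition bipartite :: "'a pair_pre_digraph \<Rightarrow> bool" where
  "bipartite G \<longleftrightarrow> (\<exists>A B. A \<union> B = pverts G \<and> A \<inter> B = {} \<and> parcs G \<subseteq> A \<times> B \<union> B \<times> A)"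

(* The sum over the finite support of f is the sum over all of V.
   Membership in the nonnegative reals includes that the sum is real. *)
definition pos_semidef_on :: "'a set \<Rightarrow> ('a \<Rightarrow> 'a \<Rightarrow> real) \<Rightarrow> bool" where
  "pos_semidef_on V K \<longleftrightarrow>
    (\<forall>f :: 'a \<Rightarrow> complex. finite {x \<in> V. f x \<noteq> 0} \<longrightarrow>
      (\<Sum>x \<in> {x \<in> V. f x \<noteq> 0}. \<Sum>y \<in> {x \<in> V. f x \<noteq> 0}. cnj (f x) * f y * of_real (K x y))
        \<in> \<real>\<^sub>\<ge>\<^sub>0)"

definition Q_matrix :: "'a pair_pre_digraph \<Rightarrow> real \<Rightarrow> 'a \<Rightarrow> 'a \<Rightarrow> real" where
  "Q_matrix G q x y = q ^ gdist G x y"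

definition psd_params :: "'a pair_pre_digraph \<Rightarrow> real set" where
  "psd_params G = {q. pos_semidef_on (pverts G) (Q_matrix G q)}"

definition hypercube :: "'b set \<Rightarrow> 'b set pair_pre_digraph" where
  "hypercube S = \<lparr> pverts = {A. A \<subseteq> S \<and> finite A},
    parcs = {(A, B). A \<subseteq> S \<and> finite A \<and> B \<subseteq> S \<and> finite B \<and>
      ((\<exists>a\<in>A. B = A - {a}) \<or> (\<exists>b\<in>B. A = B - {b}))} \<rparr>"

lemma pair_bidirected_digraph_hypercube: "pair_bidirected_digraph (hypercube S)"
  by unfold_locales (auto simp: hypercube_def symmetric_def sym_def)

lemma gdist_hypercube:
  assumes "A \<in> pverts (hypercube S)" "B \<in> pverts (hypercube S)"
  shows "gdist (hypercube S) A B = card (sym_diff A B)"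
proof -
  interpret pair_bidirected_digraph "hypercube S"
    by (rule pair_bidirected_digraph_hypercube)
  have lower: "finite A \<and> finite B \<and> card (sym_diff A B) \<le> length p" if "awalk A p B" for A B p
    using that
  proof (induction p arbitrary: A)
    case Nil
    then have "A = B" "A \<in> pverts (hypercube S)" by (auto simp: awalk_Nil_iff)
    then show ?case by (simp add: hypercube_def)
  next
    case (Cons e p)
    obtain C where e: "e = (A, C)" "(A, C) \<in> parcs (hypercube S)" and w: "awalk C p B"
      using Cons.prems by (cases e) (auto simp: awalk_Cons_iff)
    have IH: "finite C" "finite B" "card (sym_diff C B) \<le> length p"
      using Cons.IH[OF w] by auto
    have fin: "finite A" and "(\<exists>a\<in>A. C = A - {a}) \<or> (\<exists>a\<in>C. A = C - {a})"
      using e(2) by (auto simp: hypercube_def)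
    then obtain a where "sym_diff A B \<subseteq> insert a (sym_diff C B)" by blast
    then have "card (sym_diff A B) \<le> card (insert a (sym_diff C B))"
      using IH by (intro card_mono) auto
    also have "\<dots> \<le> Suc (card (sym_diff C B))"
      using IH by (simp add: card_insert_if)
    finally show ?case using IH fin by simp
  qed
  have upper: "\<exists>p. awalk A p B \<and> length p = n"
    if "card (sym_diff A B) = n" "A \<in> pverts (hypercube S)" for n A
    using that
  proof (induction n arbitrary: A)
    case 0
    then have "A = B" using assms(2) by (auto simp: hypercube_def)
    then show ?case using 0 by (auto simp: awalk_Nil_iff)
  next
    case (Suc n)
    have fin: "finite A" "A \<subseteq> S" "finite B" "B \<subseteq> S"
      using Suc.prems assms(2) by (auto simp: hypercube_def)
    obtain a where a: "a \<in> sym_diff A B"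
      using Suc.prems(1) by (metis card.empty equals0I nat.distinct(1))
    define C where "C = (if a \<in> A then A - {a} else insert a A)"
    have "sym_diff C B = sym_diff A B - {a}"
      using a by (auto simp: C_def)
    then have "card (sym_diff C B) = n"
      using Suc.prems(1) a fin by simp
    moreover have C: "C \<in> pverts (hypercube S)"
      using fin a by (auto simp: C_def hypercube_def)
    ultimately obtain p where p: "awalk C p B" "length p = n"
      using Suc.IH by blast
    have "(A, C) \<in> parcs (hypercube S)"
      using fin a by (auto simp: C_def hypercube_def)
    then have "awalk A ((A, C) # p) B" using p by (simp add: awalk_Cons_iff)
    then show ?case using p(2) by (metis length_Cons)
  qed
  show ?thesis
    unfolding gdist_def using lower upper[OF refl assms(1)]
    by (intro Least_equality) auto
qed

definition isometric_embedding ::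
  "('a \<Rightarrow> 'c) \<Rightarrow> 'a pair_pre_digraph \<Rightarrow> 'c pair_pre_digraph \<Rightarrow> bool" where
  "isometric_embedding h G H \<longleftrightarrow> h ` pverts G \<subseteq> pverts H \<and>
    (\<forall>x\<in>pverts G. \<forall>y\<in>pverts G. gdist H (h x) (h y) = gdist G x y)"

text \<open>
  HOL cannot quantify over types inside a formula, so the type of the coordinates
  is a parameter. For a graph over \<^typ>\<open>'a\<close>, the type \<^typ>\<open>'a \<times> 'a\<close> of
  the coordinates is large enough: in any isometric embedding only those coordinates matter
  that change along some edge, and each edge changes exactly one coordinate.
\<close>

definition hypercube_embeddable :: "'b itself \<Rightarrow> 'a pair_pre_digraph \<Rightarrow> bool" where
  "hypercube_embeddable _ G \<longleftrightarrow>
    (\<exists>(S :: 'b set) h. S \<noteq> {} \<and> isometric_embedding h G (hypercube S))"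

end

theory Submission
  imports Defs
begin

text \<open>
  For an edge from \<open>x\<close> to \<open>y\<close> of a bipartite graph, \<open>closer G x y\<close>
  and \<open>closer G y x\<close> are complementary halfspaces. Everything is compared with one
  property: any edge that crosses a halfspace defines the same pair of halfspaces
  (\<open>halfspaces_determined\<close>).

  The forbidden quintuple says precisely that this property fails. For convexity, a failure
  of the property gives a geodesic that leaves a halfspace in its first step and returns to it.
  Conversely, an edge that leaves a halfspace defines the same halfspace, so a geodesic that
  leaves through it moves away from all vertices of the halfspace and cannot end there
  (\<open>convex_halfspaces_iff\<close>).

  If the property holds, counting the halfspaces that separate two vertices gives their
  distance, because each edge of a geodesic crosses one pair and all these pairs are distinct.
  This is the embedding into a hypercube
  (\<open>halfspaces_determined_imp_hypercube_embeddable\<close>).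

  In a hypercube \<open>q\<^bsup>d(A, B)\<^esup>\<close> is a product over the coordinates of kernels
  on two points, and it expands into characters with nonnegative weights if
  \<open>\<bar>q\<bar> \<le> 1\<close> (\<open>power_card_sym_diff\<close>). So the matrices of an embeddable
  graph are positive semidefinite for these \<open>q\<close>; an edge excludes all others.

  In the other direction only two pieces of the interval matter. The value \<open>q = -1\<close>
  forces the graph to be bipartite. The values just below \<open>1\<close> show to first order that
  \<open>d\<close> is conditionally negative definite (\<open>conditionally_negative_definite\<close>),
  so that \<open>-d/2\<close> acts as an inner product on functions of sum zero. There, parallel edges
  become vectors of norm \<open>1\<close> with inner product \<open>1\<close>, hence equal modulo the
  radical, and equal vectors define the same halfspaces
  (\<open>psd_imp_halfspaces_determined\<close>).
\<close>

section \<open>Distances in a connected graph\<close>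

locale connected_bidirected_digraph = pair_bidirected_digraph +
  assumes connected: "Digraph_Component.connected (with_proj G)"
begin

abbreviation d :: "'a \<Rightarrow> 'a \<Rightarrow> nat" where
  "d \<equiv> gdist G"

lemma d_le: "awalk u p v \<Longrightarrow> d u v \<le> length p"
  unfolding gdist_def by (rule Least_le) auto

lemma shortest_awalk:
  assumes "u \<in> pverts G" "v \<in> pverts G"
  obtains p where "awalk u p v" "length p = d u v"
proof -
  have "u \<rightarrow>\<^sup>*\<^bsub>with_proj (mk_symmetric (with_proj G))\<^esub> v"
    using connected assms unfolding Digraph_Component.connected_def by (auto elim!: strongly_connectedE)
  then have "u \<rightarrow>\<^sup>*\<^bsub>with_proj G\<^esub> v"
    using reachable_mk_symmetric_eq[OF pair_sym_arcs] by simp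
  then obtain p where "awalk u p v"
    using reachable_awalk by auto
  then have "\<exists>n p. awalk u p v \<and> length p = n" by blast
  then have "\<exists>p. awalk u p v \<and> length p = d u v"
    unfolding gdist_def by (rule LeastI_ex)
  with that show thesis by blast
qed

lemma d_self [simp]: "u \<in> pverts G \<Longrightarrow> d u u = 0"
  using d_le[of u "[]" u] by (simp add: awalk_Nil_iff)

lemma d_eq_0D: "u \<in> pverts G \<Longrightarrow> v \<in> pverts G \<Longrightarrow> d u v = 0 \<Longrightarrow> u = v"
  by (metis shortest_awalk awalk_Nil_iff length_0_conv)

lemma d_sym: "u \<in> pverts G \<Longrightarrow> v \<in> pverts G \<Longrightarrow> d u v = d v u"
proof (rule antisym)
  have len: "length (rev_path p) = length p" for p :: "('a \<times> 'a) list"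
    by (induction p) auto
  have "d u v \<le> d v u" if V: "u \<in> pverts G" "v \<in> pverts G" for u v
  proof -
    obtain p where p: "awalk v p u" "length p = d v u"
      using shortest_awalk[OF V(2,1)] by blast
    then have "awalk u (rev_path p) v" by simp
    from d_le[OF this] show ?thesis using p len by simp
  qed
  then show "u \<in> pverts G \<Longrightarrow> v \<in> pverts G \<Longrightarrow> d u v \<le> d v u"
    "u \<in> pverts G \<Longrightarrow> v \<in> pverts G \<Longrightarrow> d v u \<le> d u v" by blast+
qed

lemma d_triangle:
  assumes "u \<in> pverts G" "v \<in> pverts G" "w \<in> pverts G"
  shows "d u w \<le> d u v + d v w"
proof -
  obtain p where p: "awalk u p v" "length p = d u v"
    using shortest_awalk assms by blast
  obtain q where q: "awalk v q w" "length q = d v w"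
    using shortest_awalk assms by blast
  from d_le[OF awalk_appendI[OF p(1) q(1)]] show ?thesis using p q by simp
qed

lemma d_arc: "(u, v) \<in> parcs G \<Longrightarrow> d u v = 1"
proof -
  assume a: "(u, v) \<in> parcs G"
  then have V: "u \<in> pverts G" "v \<in> pverts G" by (auto dest: wellformed')
  have "awalk u [(u, v)] v" using a V by (simp add: awalk_Cons_iff awalk_Nil_iff)
  from d_le[OF this] have "d u v \<le> 1" by simp
  moreover have "d u v \<noteq> 0" using d_eq_0D[OF V] pair_no_loops[OF a] by auto
  ultimately show ?thesis by simp
qed

lemma d_step:
  assumes "d u v = Suc n" "u \<in> pverts G" "v \<in> pverts G"
  obtains w where "(u, w) \<in> parcs G" "d w v = n"
proof -
  obtain p where p: "awalk u p v" "length p = Suc n"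
    using shortest_awalk assms by metis
  then obtain w q where q: "p = (u, w) # q"
    by (cases p) (auto simp: awalk_Cons_iff)
  with p have w: "(u, w) \<in> parcs G" "awalk w q v" "length q = n"
    by (auto simp: awalk_Cons_iff)
  have "d w v \<le> n" using d_le w by blast
  moreover have "d u v \<le> 1 + d w v"
    using d_triangle[of u w v] d_arc[OF w(1)] assms wellformed'[OF w(1)] by simp
  ultimately have "d w v = n" using assms by simp
  with that w show thesis by blast
qed

lemma d_arc_le:
  assumes "(x, y) \<in> parcs G" "z \<in> pverts G"
  shows "d z y \<le> Suc (d z x)"
  using d_triangle[of z x y] d_arc[of x y] assms wellformed'[OF assms(1)] by simp

lemma d_along_awalk:
  assumes "awalk u p v" "w \<in> set (awalk_verts u p)"
  shows "d u w + d w v \<le> length p"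
proof -
  obtain q r where "p = q @ r" "awalk u q w" "awalk w r v"
    using awalk_decomp[OF assms] by blast
  then show ?thesis using d_le[of u q w] d_le[of w r v] by simp
qed

text \<open>Shortest walks do not repeat vertices: every later vertex is strictly nearer to the end.\<close>

lemma shortest_awalk_apath:
  assumes "awalk u p v" "length p = d u v"
  shows "apath u p v"
  using assms
proof (induction p arbitrary: u)
  case Nil
  then show ?case by (simp add: apath_def)
next
  case (Cons e p)
  obtain w where e: "e = (u, w)" "(u, w) \<in> parcs G" and w: "awalk w p v"
    using Cons.prems by (cases e) (auto simp: awalk_Cons_iff)
  have V: "u \<in> pverts G" "w \<in> pverts G" "v \<in> pverts G"
    using wellformed'[OF e(2)] awalk_last_in_verts[OF w] by auto
  have "d u v \<le> Suc (d w v)"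
    using d_triangle[of u w v] d_arc[OF e(2)] V by simp
  then have "length p = d w v"
    using d_le[OF w] Cons.prems by simp
  then have "apath w p v" using Cons.IH w by blast
  moreover have "u \<notin> set (awalk_verts w p)"
    using d_along_awalk[OF w] Cons.prems by fastforce
  ultimately show ?case using e w Cons.prems by (simp add: apath_def)
qed

text \<open>Convexity thus only depends on which triples of vertices satisfy the triangle
  inequality with equality.\<close>

lemma geodesically_convex_iff:
  assumes "S \<subseteq> pverts G"
  shows "geodesically_convex G S \<longleftrightarrow>
    (\<forall>u\<in>S. \<forall>v\<in>S. \<forall>w\<in>pverts G. d u w + d w v = d u v \<longrightarrow> w \<in> S)"
proof (intro iffI ballI impI)
  fix u v w
  assume conv: "geodesically_convex G S" and uv: "u \<in> S" "v \<in> S" and w: "w \<in> pverts G"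
    and eq: "d u w + d w v = d u v"
  obtain p where p: "awalk u p w" "length p = d u w"
    using shortest_awalk assms uv w by blast
  obtain q where q: "awalk w q v" "length q = d w v"
    using shortest_awalk assms uv w by blast
  have pq: "awalk u (p @ q) v" using awalk_appendI p q by blast
  then have "apath u (p @ q) v" using p q eq by (intro shortest_awalk_apath) auto
  then have "geodesic G u (p @ q) v" using p q eq by (simp add: geodesic_def)
  then have "set (awalk_verts u (p @ q)) \<subseteq> S"
    using conv uv unfolding geodesically_convex_def by (metis awalk_verts_with_proj_eq)
  moreover have "w \<in> set (awalk_verts u (p @ q))"
    using awalk_verts_append[OF pq] p
    by (metis UnCI awalkE awalk_verts_ne_eq last_in_set set_append awalk_verts_non_Nil)
  ultimately show "w \<in> S" by blast
next
  assume between: "\<forall>u\<in>S. \<forall>v\<in>S. \<forall>w\<in>pverts G. d u w + d w v = d u v \<longrightarrow> w \<in> S"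
  show "geodesically_convex G S"
    unfolding geodesically_convex_def
  proof (intro ballI allI impI subsetI)
    fix u v p w
    assume uv: "u \<in> S" "v \<in> S" and g: "geodesic G u p v"
      and "w \<in> set (pre_digraph.awalk_verts (with_proj G) u p)"
    then have w: "w \<in> set (awalk_verts u p)" by simp
    have p: "awalk u p v" "length p = d u v"
      using g by (auto simp: geodesic_def apath_def)
    have wV: "w \<in> pverts G" using awalk_verts_in_verts[OF _ _ w] p uv assms by blast
    have "d u w + d w v \<le> d u v" using d_along_awalk[OF p(1) w] p by simp
    moreover have "d u v \<le> d u w + d w v" using d_triangle uv assms wV by blast
    ultimately have "d u w + d w v = d u v" by simp
    then show "w \<in> S" using between uv wV by blast
  qed
qed

section \<open>Bipartite graphs and their halfspaces\<close>

text \<open>Adjacent vertices have distances of different parity to any third vertex in a bipartite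
  graph. Conversely, since these distances differ by at most one, differing distances have
  different parity, and the parity of the distance to a base vertex is a 2-colouring.\<close>

lemma bipartite_iff:
  "bipartite G \<longleftrightarrow> (\<forall>(x, y)\<in>parcs G. \<forall>z\<in>pverts G. d z x \<noteq> d z y)"
proof
  assume "bipartite G"
  then obtain A B where AB: "A \<union> B = pverts G" "A \<inter> B = {}" "parcs G \<subseteq> A \<times> B \<union> B \<times> A"
    unfolding bipartite_def by blast
  have par: "even (length p) \<longleftrightarrow> (u \<in> A \<longleftrightarrow> v \<in> A)" if "awalk u p v" for u p v
    using that
  proof (induction p arbitrary: u)
    case Nil
    then show ?case by (simp add: awalk_Nil_iff)
  next
    case (Cons e p)
    obtain w where "(u, w) \<in> parcs G" "awalk w p v"
      using Cons.prems by (cases e) (auto simp: awalk_Cons_iff)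
    with Cons.IH[of w] AB show ?case by auto
  qed
  have "even (d u v) \<longleftrightarrow> (u \<in> A \<longleftrightarrow> v \<in> A)" if "u \<in> pverts G" "v \<in> pverts G" for u v
    using shortest_awalk[OF that] par by metis
  moreover have "x \<in> A \<longleftrightarrow> y \<notin> A" if "(x, y) \<in> parcs G" for x y
    using AB that by auto
  ultimately show "\<forall>(x, y)\<in>parcs G. \<forall>z\<in>pverts G. d z x \<noteq> d z y"
    by (clarsimp) (metis in_arcsD1 in_arcsD2)
next
  assume ne: "\<forall>(x, y)\<in>parcs G. \<forall>z\<in>pverts G. d z x \<noteq> d z y"
  show "bipartite G"
  proof (cases "pverts G = {}")
    case True
    then show ?thesis unfolding bipartite_def by (auto dest: wellformed')
  next
    case False
    then obtain b where b: "b \<in> pverts G" by blast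
    have parity: "even (d b x) \<longleftrightarrow> odd (d b y)" if a: "(x, y) \<in> parcs G" for x y
    proof -
      have "d b x = Suc (d b y) \<or> d b y = Suc (d b x)"
        using d_arc_le[OF a b] d_arc_le[OF arcs_symmetric[OF a] b] ne a b by fastforce
      then show ?thesis by auto
    qed
    show ?thesis
      unfolding bipartite_def
    proof (intro exI conjI)
      let ?A = "{x \<in> pverts G. even (d b x)}" and ?B = "{x \<in> pverts G. odd (d b x)}"
      show "?A \<union> ?B = pverts G" "?A \<inter> ?B = {}" by auto
      show "parcs G \<subseteq> ?A \<times> ?B \<union> ?B \<times> ?A"
      proof (rule subrelI)
        fix x y assume a: "(x, y) \<in> parcs G"
        from parity[OF a] show "(x, y) \<in> ?A \<times> ?B \<union> ?B \<times> ?A"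
          using wellformed'[OF a] by blast
      qed
    qed
  qed
qed

lemma closer_iff: "z \<in> closer G x y \<longleftrightarrow> z \<in> pverts G \<and> d z y = Suc (d z x)"
proof -
  have "int (d z x) = int (d z y) - 1 \<longleftrightarrow> d z y = Suc (d z x)" by linarith
  then show ?thesis by (simp add: closer_def)
qed

lemma closer_subset: "closer G x y \<subseteq> pverts G"
  by (auto simp: closer_def)

lemma not_closer_iff:
  assumes "bipartite G" "(x, y) \<in> parcs G" "z \<in> pverts G"
  shows "z \<notin> closer G x y \<longleftrightarrow> z \<in> closer G y x"
proof -
  have "d z x \<noteq> d z y"
    using assms(1) unfolding bipartite_iff using assms(2,3) by auto
  then have "d z y \<noteq> Suc (d z x) \<longleftrightarrow> d z x = Suc (d z y)"
    using d_arc_le[OF assms(2,3)] d_arc_le[OF arcs_symmetric[OF assms(2)] assms(3)] by linarith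
  then show ?thesis using assms(3) by (simp add: closer_iff)
qed

text \<open>This is the common form of the two combinatorial conditions. For bipartite graphs it says
  that the Djokovic relation on edges is transitive.\<close>

definition halfspaces_determined :: bool where
  "halfspaces_determined \<longleftrightarrow> (\<forall>x y u v. (x, y) \<in> parcs G \<longrightarrow> (u, v) \<in> parcs G \<longrightarrow>
    u \<in> closer G x y \<longrightarrow> v \<in> closer G y x \<longrightarrow> closer G x y = closer G u v)"

text \<open>One inclusion between the two halfspaces suffices, since reversing both edges
  exchanges each halfspace with its complement.\<close>

lemma halfspaces_determinedI:
  assumes bip: "bipartite G"
    and sub: "\<And>x y u v z. \<lbrakk>(x, y) \<in> parcs G; (u, v) \<in> parcs G; u \<in> closer G x y;
      v \<in> closer G y x; z \<in> closer G x y; z \<in> closer G v u\<rbrakk> \<Longrightarrow> False"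
  shows halfspaces_determined
  unfolding halfspaces_determined_def
proof (intro allI impI)
  fix x y u v
  assume a: "(x, y) \<in> parcs G" "(u, v) \<in> parcs G" "u \<in> closer G x y" "v \<in> closer G y x"
  note swap = arcs_symmetric[OF a(1)] arcs_symmetric[OF a(2)]
  show "closer G x y = closer G u v"
  proof (intro set_eqI)
    fix z
    show "z \<in> closer G x y \<longleftrightarrow> z \<in> closer G u v"
    proof (cases "z \<in> pverts G")
      case True
      then show ?thesis
        using sub[OF a, of z] sub[OF swap a(4,3), of z]
          not_closer_iff[OF bip a(1) True] not_closer_iff[OF bip a(2) True] by blast
    qed (auto simp: closer_def)
  qed
qed

lemma no_quintuple_iff:
  assumes bip: "bipartite G"
  shows "\<not> (\<exists>x1\<in>pverts G. \<exists>x2\<in>pverts G. \<exists>x3\<in>pverts G. \<exists>x4\<in>pverts G. \<exists>x5\<in>pverts G.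
          (x1, x2) \<in> parcs G \<and> (x3, x4) \<in> parcs G \<and>
          x3 \<in> closer G x1 x2 \<and> x4 \<in> closer G x2 x1 \<and>
          x5 \<in> closer G x1 x2 \<inter> closer G x4 x3) \<longleftrightarrow> halfspaces_determined"
    (is "\<not> ?Q \<longleftrightarrow> _")
proof
  assume no: "\<not> ?Q"
  show halfspaces_determined
  proof (rule halfspaces_determinedI[OF bip])
    fix x y u v z
    assume a: "(x, y) \<in> parcs G" "(u, v) \<in> parcs G" "u \<in> closer G x y"
      "v \<in> closer G y x" "z \<in> closer G x y" "z \<in> closer G v u"
    then have "z \<in> pverts G" by (simp add: closer_iff)
    with no a show False
      using wellformed'[OF a(1)] wellformed'[OF a(2)] by blast
  qed
next
  assume det: halfspaces_determined
  show "\<not> ?Q"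
  proof
    assume ?Q
    then obtain x1 x2 x3 x4 x5 where x: "(x1, x2) \<in> parcs G" "(x3, x4) \<in> parcs G"
      "x3 \<in> closer G x1 x2" "x4 \<in> closer G x2 x1" "x5 \<in> closer G x1 x2" "x5 \<in> closer G x4 x3"
      by blast
    then have "closer G x1 x2 = closer G x3 x4"
      using det unfolding halfspaces_determined_def by blast
    then show False using x by (auto simp: closer_iff)
  qed
qed

text \<open>From determinedness to convexity, the vertex \<open>w\<close> between \<open>u\<close> and \<open>v\<close>
  is reached from \<open>u\<close> by steps towards \<open>v\<close>. A step out of the halfspace would
  define it, so \<open>v\<close> would be nearer to the start of the step than to its end.\<close>

lemma convex_halfspaces_iff:
  assumes bip: "bipartite G"
  shows "(\<forall>(x, y)\<in>parcs G. geodesically_convex G (closer G x y)) \<longleftrightarrow> halfspaces_determined"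
proof
  assume conv: "\<forall>(x, y)\<in>parcs G. geodesically_convex G (closer G x y)"
  show halfspaces_determined
  proof (rule halfspaces_determinedI[OF bip])
    fix x y u v z
    assume a: "(x, y) \<in> parcs G" "(u, v) \<in> parcs G" "u \<in> closer G x y" "v \<in> closer G y x"
      "z \<in> closer G x y" "z \<in> closer G v u"
    have V: "u \<in> pverts G" "v \<in> pverts G" "z \<in> pverts G"
      using a by (auto simp: closer_iff)
    \<comment> \<open>The edge from \<open>u\<close> to \<open>v\<close> is the beginning of a geodesic from \<open>u\<close> to \<open>z\<close>.\<close>
    have "d u v + d v z = d u z"
      using a(6) d_arc[OF a(2)] d_sym[OF V(1,3)] d_sym[OF V(2,3)] by (simp add: closer_iff)
    moreover have "geodesically_convex G (closer G x y)" using conv a by blast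
    ultimately have "v \<in> closer G x y"
      using geodesically_convex_iff[OF closer_subset] a(3,5) V(2) by blast
    then show False using a(4) by (simp add: closer_iff)
  qed
next
  assume det: halfspaces_determined
  show "\<forall>(x, y)\<in>parcs G. geodesically_convex G (closer G x y)"
  proof safe
    fix x y assume a: "(x, y) \<in> parcs G"
    have "w \<in> closer G x y"
      if "u \<in> closer G x y" "v \<in> closer G x y" "w \<in> pverts G" "d u w + d w v = d u v" for u v w
      using that
    proof (induction "d u w" arbitrary: u)
      case 0
      then show ?case using d_eq_0D[of u w] by (simp add: closer_iff)
    next
      case (Suc n)
      have V: "u \<in> pverts G" "v \<in> pverts G" "w \<in> pverts G"
        using Suc.prems by (auto simp: closer_iff)
      obtain u' where u': "(u, u') \<in> parcs G" "d u' w = n"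
        using d_step[OF Suc.hyps(2)[symmetric] V(1,3)] by blast
      have V': "u' \<in> pverts G" using u' by (auto dest: wellformed')
      have le: "d u' v \<le> n + d w v" using d_triangle[OF V' V(3,2)] u' by simp
      have ge: "d u v \<le> Suc (d u' v)"
        using d_triangle[OF V(1) V' V(2)] d_arc[OF u'(1)] by simp
      have "u' \<in> closer G x y"
      proof (rule ccontr)
        assume "u' \<notin> closer G x y"
        then have "u' \<in> closer G y x" using not_closer_iff[OF bip a V'] by blast
        then have "closer G x y = closer G u u'"
          using det a u'(1) Suc.prems(1) unfolding halfspaces_determined_def by blast
        then have "d v u' = Suc (d v u)" using Suc.prems(2) by (simp add: closer_iff)
        then show False
          using le Suc.hyps(2) Suc.prems(4) d_sym[OF V(2) V'] d_sym[OF V(2,1)] by linarith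
      qed
      moreover have "d u' w + d w v = d u' v"
        using le ge u'(2) Suc.hyps(2) Suc.prems(4) by linarith
      ultimately show ?case using Suc.hyps(1)[of u'] u' Suc.prems by blast
    qed
    then show "geodesically_convex G (closer G x y)"
      unfolding geodesically_convex_iff[OF closer_subset] by blast
  qed
qed

end

section \<open>Positive semidefinite kernels\<close>

lemma sum_fibres:
  fixes c :: "'i \<Rightarrow> real"
  assumes "finite I"
  shows "(\<Sum>x\<in>p ` I. (\<Sum>i\<in>{i \<in> I. p i = x}. c i) * g x) = (\<Sum>i\<in>I. c i * g (p i))"
proof -
  have "(\<Sum>i\<in>I. c i * g (p i)) = (\<Sum>x\<in>p ` I. \<Sum>i\<in>{i \<in> I. p i = x}. c i * g (p i))"
    using assms by (rule sum.image_gen)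
  also have "\<dots> = (\<Sum>x\<in>p ` I. (\<Sum>i\<in>{i \<in> I. p i = x}. c i) * g x)"
    by (intro sum.cong refl) (simp add: sum_distrib_right)
  finally show ?thesis ..
qed

text \<open>Testing positive semidefiniteness on families of points that may coincide is more
  convenient than testing it on finitely supported functions: no case distinction on equal
  vertices arises. Coinciding points contribute the sum of their coefficients.\<close>

lemma pos_semidef_on_family:
  fixes c :: "'i \<Rightarrow> real"
  assumes psd: "pos_semidef_on V K" and fin: "finite I" and sub: "p ` I \<subseteq> V"
  shows "0 \<le> (\<Sum>i\<in>I. \<Sum>j\<in>I. c i * c j * K (p i) (p j))"
proof -
  define f where "f x = (\<Sum>i\<in>{i \<in> I. p i = x}. c i)" for x
  define S where "S = {x \<in> V. complex_of_real (f x) \<noteq> 0}"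
  have zero: "f x = 0" if "x \<notin> p ` I" for x
  proof -
    have "{i \<in> I. p i = x} = {}" using that by auto
    then show ?thesis unfolding f_def by (simp only: sum.empty)
  qed
  have S_sub: "S \<subseteq> p ` I" using zero by (auto simp: S_def)
  then have "finite S" using fin by (meson finite_imageI finite_subset)
  then have "(\<Sum>x\<in>S. \<Sum>y\<in>S. cnj (f x) * f y * complex_of_real (K x y)) \<in> \<real>\<^sub>\<ge>\<^sub>0"
    using psd[unfolded pos_semidef_on_def, THEN spec, of "\<lambda>x. complex_of_real (f x)"]
    unfolding S_def by blast
  also have "(\<Sum>x\<in>S. \<Sum>y\<in>S. cnj (f x) * f y * complex_of_real (K x y))
      = complex_of_real (\<Sum>x\<in>S. \<Sum>y\<in>S. f x * f y * K x y)" by simp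
  finally have "0 \<le> (\<Sum>x\<in>S. \<Sum>y\<in>S. f x * f y * K x y)"
    by (simp only: nonneg_Reals_of_real_iff)
  also have "\<dots> = (\<Sum>x\<in>S. f x * (\<Sum>y\<in>S. f y * K x y))"
    by (simp add: sum_distrib_left mult.assoc)
  also have "\<dots> = (\<Sum>x\<in>p ` I. f x * (\<Sum>y\<in>p ` I. f y * K x y))"
  proof -
    have *: "(\<Sum>x\<in>S. f x * g x) = (\<Sum>x\<in>p ` I. f x * g x)" for g
      using fin S_sub sub by (intro sum.mono_neutral_left) (auto simp: S_def)
    show ?thesis unfolding * ..
  qed
  also have "\<dots> = (\<Sum>i\<in>I. c i * (\<Sum>j\<in>I. c j * K (p i) (p j)))"
    unfolding f_def sum_fibres[OF fin] ..
  finally show ?thesis by (simp add: sum_distrib_left mult.assoc)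
qed

text \<open>Positive semidefiniteness of \<open>q\<^sup>d\<close> for \<open>q\<close> below \<open>1\<close> forces \<open>d\<close> to be conditionally
  negative definite. For coefficients of sum zero the quadratic form of \<open>q\<^sup>d\<close> is that of
  \<open>q\<^sup>d - 1 = (q - 1) (1 + q + \<dots> + q\<^bsup>d-1\<^esup>)\<close>; division by \<open>q - 1 < 0\<close> reverses
  the inequality, and the geometric sum becomes \<open>d\<close> as \<open>q\<close> tends to \<open>1\<close>.\<close>

lemma conditionally_negative_definite:
  fixes c :: "'i \<Rightarrow> real"
  assumes psd: "\<And>q. 0 < q \<Longrightarrow> q < 1 \<Longrightarrow> pos_semidef_on V (\<lambda>x y. q ^ dst x y)"
    and fin: "finite I" and sub: "p ` I \<subseteq> V" and zero: "sum c I = 0"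
  shows "(\<Sum>i\<in>I. \<Sum>j\<in>I. c i * c j * real (dst (p i) (p j))) \<le> 0"
proof -
  define g where "g q = (\<Sum>i\<in>I. \<Sum>j\<in>I. c i * c j * (\<Sum>k<dst (p i) (p j). q ^ k))" for q :: real
  have "g q \<le> 0" if q: "0 < q" "q < 1" for q
  proof -
    have geo: "(1 - q) * (\<Sum>k<n. q ^ k) = 1 - q ^ n" for n
      by (rule one_diff_power_eq[symmetric])
    have "(1 - q) * g q
        = (\<Sum>i\<in>I. \<Sum>j\<in>I. c i * c j * ((1 - q) * (\<Sum>k<dst (p i) (p j). q ^ k)))"
      unfolding g_def by (simp only: sum_distrib_left mult.left_commute)
    also have "\<dots> = (\<Sum>i\<in>I. \<Sum>j\<in>I. c i * c j - c i * c j * q ^ dst (p i) (p j))"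
      by (simp only: geo right_diff_distrib mult_1_right)
    also have "\<dots> = sum c I * sum c I - (\<Sum>i\<in>I. \<Sum>j\<in>I. c i * c j * q ^ dst (p i) (p j))"
      by (simp only: sum_subtractf sum_product)
    also have "\<dots> \<le> 0"
      using pos_semidef_on_family[OF psd[OF q] fin sub, of c] zero by simp
    finally show ?thesis using q by (simp add: mult_le_0_iff)
  qed
  then have "\<forall>\<^sub>F q in at_left 1. g q \<le> 0"
    unfolding eventually_at_left_field by (intro exI[of _ 0]) auto
  moreover have "(g \<longlongrightarrow> g 1) (at_left 1)"
    unfolding g_def by (intro tendsto_intros)
  ultimately have "g 1 \<le> 0"
    by (intro tendsto_upperbound[of g "g 1" "at_left 1"]) auto
  then show ?thesis by (simp add: g_def)
qed

section \<open>The distance kernel of a hypercube\<close>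

text \<open>These are the Walsh functions: the characters of the group of finite sets under
  symmetric difference.\<close>

definition character :: "'b set \<Rightarrow> 'b set \<Rightarrow> real" where
  "character R A = (\<Prod>t\<in>R. if t \<in> A then -1 else 1)"

definition weight :: "real \<Rightarrow> 'b set \<Rightarrow> 'b set \<Rightarrow> real" where
  "weight q T R = ((1 - q) / 2) ^ card R * ((1 + q) / 2) ^ card (T - R)"

text \<open>For a single coordinate, \<open>q\<close> to the power \<open>0\<close> or \<open>1\<close> equals
  \<open>(1 - q)/2 \<sigma> \<tau> + (1 + q)/2\<close>, where the signs \<open>\<sigma>\<close> and \<open>\<tau>\<close>
  record membership. Expanding the product over all coordinates diagonalises the kernel by
  the characters of the hypercube, with weights that are nonnegative for \<open>\<bar>q\<bar> \<le> 1\<close>.\<close>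

lemma power_card_sym_diff:
  assumes fin: "finite T" and sub: "A \<subseteq> T" "B \<subseteq> T"
  shows "q ^ card (sym_diff A B) = (\<Sum>R\<in>Pow T. weight q T R * (character R A * character R B))"
proof -
  let ?s = "\<lambda>A t. if t \<in> A then -1 else 1 :: real"
  have "(\<Prod>t\<in>T. (1 - q) / 2 * (?s A t * ?s B t) + (1 + q) / 2)
      = (\<Prod>t\<in>T. if t \<in> sym_diff A B then q else 1)"
    by (intro prod.cong refl) (auto simp: field_simps)
  also have "\<dots> = (\<Prod>t\<in>T \<inter> sym_diff A B. q)"
    using fin by (rule prod.inter_restrict[symmetric])
  also have "T \<inter> sym_diff A B = sym_diff A B" using sub by auto
  finally have "q ^ card (sym_diff A B)
      = (\<Prod>t\<in>T. (1 - q) / 2 * (?s A t * ?s B t) + (1 + q) / 2)" by simp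
  also have "\<dots> = (\<Sum>R\<in>Pow T. (\<Prod>t\<in>R. (1 - q) / 2 * (?s A t * ?s B t)) * (\<Prod>t\<in>T - R. (1 + q) / 2))"
    using fin by (rule prod_add)
  also have "\<dots> = (\<Sum>R\<in>Pow T. weight q T R * (character R A * character R B))"
    by (intro sum.cong refl) (simp only: weight_def character_def prod.distrib prod_constant mult_ac)
  finally show ?thesis .
qed

text \<open>A finitely supported test function involves only finitely many coordinates, and on these the
  quadratic form is a weighted sum of squares \<open>\<bar>F R\<bar>\<^sup>2\<close> of its Walsh
  coefficients.\<close>

lemma pos_semidef_on_sym_diff:
  fixes h :: "'a \<Rightarrow> 'b set"
  assumes q: "-1 \<le> q" "q \<le> 1" and fin_h: "\<And>x. x \<in> V \<Longrightarrow> finite (h x)"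
  shows "pos_semidef_on V (\<lambda>x y. q ^ card (sym_diff (h x) (h y)))"
  unfolding pos_semidef_on_def
proof (intro allI impI)
  fix f :: "'a \<Rightarrow> complex"
  define S where "S = {x \<in> V. f x \<noteq> 0}"
  assume "finite {x \<in> V. f x \<noteq> 0}"
  then have fin: "finite S" by (simp add: S_def)
  define T where "T = (\<Union>x\<in>S. h x)"
  have T: "finite T" "\<And>x. x \<in> S \<Longrightarrow> h x \<subseteq> T"
    using fin fin_h by (auto simp: T_def S_def)
  define F where "F R = (\<Sum>x\<in>S. f x * of_real (character R (h x)))" for R
  have "(\<Sum>x\<in>S. \<Sum>y\<in>S. cnj (f x) * f y * of_real (q ^ card (sym_diff (h x) (h y))))
      = (\<Sum>x\<in>S. \<Sum>y\<in>S. \<Sum>R\<in>Pow T. of_real (weight q T R)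
          * (cnj (f x * of_real (character R (h x))) * (f y * of_real (character R (h y)))))"
  proof (intro sum.cong refl)
    fix x y assume xy: "x \<in> S" "y \<in> S"
    show "cnj (f x) * f y * of_real (q ^ card (sym_diff (h x) (h y)))
      = (\<Sum>R\<in>Pow T. of_real (weight q T R)
          * (cnj (f x * of_real (character R (h x))) * (f y * of_real (character R (h y)))))"
      unfolding power_card_sym_diff[OF T(1) T(2)[OF xy(1)] T(2)[OF xy(2)]]
      by (simp add: sum_distrib_left mult_ac)
  qed
  also have "\<dots> = (\<Sum>x\<in>S. \<Sum>R\<in>Pow T. \<Sum>y\<in>S. of_real (weight q T R)
          * (cnj (f x * of_real (character R (h x))) * (f y * of_real (character R (h y)))))"
    by (intro sum.cong refl sum.swap)
  also have "\<dots> = (\<Sum>R\<in>Pow T. \<Sum>x\<in>S. \<Sum>y\<in>S. of_real (weight q T R)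
          * (cnj (f x * of_real (character R (h x))) * (f y * of_real (character R (h y)))))"
    by (rule sum.swap)
  also have "\<dots> = (\<Sum>R\<in>Pow T. of_real (weight q T R) * (cnj (F R) * F R))"
    unfolding F_def cnj_sum sum_product by (simp only: sum_distrib_left)
  also have "\<dots> = of_real (\<Sum>R\<in>Pow T. weight q T R * (cmod (F R))\<^sup>2)"
    unfolding of_real_sum of_real_mult complex_norm_square by (simp only: mult.commute)
  also have "\<dots> \<in> \<real>\<^sub>\<ge>\<^sub>0"
    using q by (intro iffD2[OF nonneg_Reals_of_real_iff] sum_nonneg mult_nonneg_nonneg) (auto simp: weight_def)
  finally show "(\<Sum>x\<in>{x \<in> V. f x \<noteq> 0}. \<Sum>y\<in>{x \<in> V. f x \<noteq> 0}.
      cnj (f x) * f y * of_real (q ^ card (sym_diff (h x) (h y)))) \<in> \<real>\<^sub>\<ge>\<^sub>0"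
    unfolding S_def .
qed

section \<open>From positive semidefiniteness to halfspaces and back\<close>

lemma pos_semidef_on_cong:
  assumes "\<And>x y. x \<in> V \<Longrightarrow> y \<in> V \<Longrightarrow> K x y = L x y"
  shows "pos_semidef_on V K = pos_semidef_on V L"
proof -
  have "(\<Sum>x\<in>{x \<in> V. f x \<noteq> 0}. \<Sum>y\<in>{x \<in> V. f x \<noteq> 0}. cnj (f x) * f y * complex_of_real (K x y))
    = (\<Sum>x\<in>{x \<in> V. f x \<noteq> 0}. \<Sum>y\<in>{x \<in> V. f x \<noteq> 0}. cnj (f x) * f y * complex_of_real (L x y))" for f
    using assms by (intro sum.cong refl) simp
  then show ?thesis unfolding pos_semidef_on_def by simp
qed

context connected_bidirected_digraph
begin

lemma psd_params_family:
  fixes c :: "'i \<Rightarrow> real"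
  assumes "q \<in> psd_params G" "finite I" "p ` I \<subseteq> pverts G"
  shows "0 \<le> (\<Sum>i\<in>I. \<Sum>j\<in>I. c i * c j * q ^ d (p i) (p j))"
  using pos_semidef_on_family[of "pverts G" "Q_matrix G q" I p c] assms
  by (simp add: psd_params_def Q_matrix_def)

text \<open>The principal minor of an edge is \<open>1 - q\<^sup>2\<close>.\<close>

lemma psd_params_subset:
  assumes a: "(x, y) \<in> parcs G"
  shows "psd_params G \<subseteq> {-1..1}"
proof
  fix q assume q: "q \<in> psd_params G"
  have V: "x \<in> pverts G" "y \<in> pverts G" using wellformed'[OF a] by auto
  have dist: "d x x = 0" "d y y = 0" "d x y = 1" "d y x = 1"
    using V a d_arc arcs_symmetric by auto
  have "0 \<le> 1 + 2 * s * q + s * s" for s :: real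
    using psd_params_family[OF q, of "{0, 1 :: nat}" "\<lambda>i. [x, y] ! i" "\<lambda>i. [1, s] ! i"] V dist
    by (simp add: algebra_simps)
  from this[of 1] this[of "-1"] show "q \<in> {-1..1}" by simp
qed

text \<open>The matrix of \<open>G\<close> is the pullback of the matrix of the hypercube along the
  embedding, and pulling back preserves positive semidefiniteness. The type of the
  coordinates is arbitrary here, so that embeddability over any type yields it over
  \<^typ>\<open>'a \<times> 'a\<close>.\<close>

theorem hypercube_embeddable_imp_psd_params:
  assumes emb: "hypercube_embeddable TYPE('b) G" and a: "(x, y) \<in> parcs G"
  shows "psd_params G = {-1..1}"
proof
  show "psd_params G \<subseteq> {-1..1}" using psd_params_subset a by blast
  show "{-1..1} \<subseteq> psd_params G"
  proof
    fix q :: real assume q: "q \<in> {-1..1}"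
    obtain S :: "'b set" and h where h: "isometric_embedding h G (hypercube S)"
      using emb unfolding hypercube_embeddable_def by blast
    have verts: "h x \<in> pverts (hypercube S)" if "x \<in> pverts G" for x
      using h that unfolding isometric_embedding_def by blast
    have "d x y = card (sym_diff (h x) (h y))" if "x \<in> pverts G" "y \<in> pverts G" for x y
      using h that gdist_hypercube[OF verts verts] unfolding isometric_embedding_def by metis
    then have "pos_semidef_on (pverts G) (Q_matrix G q)
        = pos_semidef_on (pverts G) (\<lambda>x y. q ^ card (sym_diff (h x) (h y)))"
      by (intro pos_semidef_on_cong) (simp add: Q_matrix_def)
    moreover have "pos_semidef_on (pverts G) (\<lambda>x y. q ^ card (sym_diff (h x) (h y)))"
      using q verts by (intro pos_semidef_on_sym_diff) (auto simp: hypercube_def)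
    ultimately show "q \<in> psd_params G" by (simp add: psd_params_def)
  qed
qed

text \<open>For \<open>q = -1\<close>, the sum of the unit vectors of two adjacent vertices is isotropic, hence
  in the radical of a semidefinite form. So the parities of the distances from any \<open>z\<close> to the
  two ends of an edge differ. If they agreed, adding a suitable multiple of this isotropic vector
  to the unit vector of \<open>z\<close> would give a negative value.\<close>

lemma psd_minus_one_imp_bipartite:
  assumes psd: "-1 \<in> psd_params G"
  shows "bipartite G"
proof -
  have "d z x \<noteq> d z y" if a: "(x, y) \<in> parcs G" and z: "z \<in> pverts G" for x y z
  proof
    assume eq: "d z x = d z y"
    have V: "x \<in> pverts G" "y \<in> pverts G" using wellformed'[OF a] by auto
    have dist: "d x x = 0" "d y y = 0" "d z z = 0" "d x y = 1" "d y x = 1"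
      "d z y = d z x" "d x z = d z x" "d y z = d z x"
      using V a z d_arc arcs_symmetric eq d_sym[of x z] d_sym[of y z] by auto
    define \<epsilon> :: real where "\<epsilon> = (-1) ^ d z x"
    have \<epsilon>: "\<epsilon> * \<epsilon> = 1" by (simp add: \<epsilon>_def flip: power_add mult_2)
    have "0 \<le> (\<Sum>i\<in>{0, 1, 2 :: nat}. \<Sum>j\<in>{0, 1, 2}.
        [1, - \<epsilon>, - \<epsilon>] ! i * [1, - \<epsilon>, - \<epsilon>] ! j * (-1) ^ d ([z, x, y] ! i) ([z, x, y] ! j))"
      using psd V z by (intro psd_params_family) auto
    also have "\<dots> = 1 - 4 * (\<epsilon> * \<epsilon>)"
      using dist by (simp add: algebra_simps flip: \<epsilon>_def)
    finally show False using \<epsilon> by simp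
  qed
  then show ?thesis unfolding bipartite_iff by blast
qed

text \<open>The form \<open>B(f, g) = - 1/2 \<Sum> f(x) g(y) d(x, y)\<close> is positive semidefinite on
  functions of sum zero. If the edge from \<open>u\<close> to \<open>v\<close> crosses in parallel to
  the edge from \<open>x\<close> to \<open>y\<close>, then \<open>e\<^sub>x - e\<^sub>y\<close> and
  \<open>e\<^sub>u - e\<^sub>v\<close> are unit vectors with inner product \<open>1\<close>, so their
  difference lies in the radical. A vertex \<open>z\<close> on different sides of the two edges
  contradicts this: \<open>e\<^sub>z - e\<^sub>x\<close> is orthogonal to the first vector but not to
  the second.\<close>

lemma psd_imp_halfspaces_determined:
  assumes bip: "bipartite G" and psd: "{0<..<1} \<subseteq> psd_params G"
  shows halfspaces_determined
proof (rule halfspaces_determinedI[OF bip])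
  fix x y u v z
  assume a: "(x, y) \<in> parcs G" "(u, v) \<in> parcs G" "u \<in> closer G x y" "v \<in> closer G y x"
    "z \<in> closer G x y" "z \<in> closer G v u"
  have V: "x \<in> pverts G" "y \<in> pverts G" "u \<in> pverts G" "v \<in> pverts G" "z \<in> pverts G"
    using wellformed'[OF a(1)] wellformed'[OF a(2)] a(5) by (auto simp: closer_iff)
  have near: "d u y = Suc (d u x)" "d v x = Suc (d v y)" "d z y = Suc (d z x)" "d z u = Suc (d z v)"
    using a by (auto simp: closer_iff)
  have "d v y = d u x"
    using d_arc_le[OF a(2) V(1)] d_arc_le[OF arcs_symmetric[OF a(2)] V(2)] near
      d_sym[OF V(1,3)] d_sym[OF V(1,4)] d_sym[OF V(2,3)] d_sym[OF V(2,4)] by linarith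
  note dist = this near d_self[OF V(1)] d_self[OF V(2)] d_self[OF V(3)] d_self[OF V(4)] d_self[OF V(5)]
    d_arc[OF a(1)] d_arc[OF a(2)] d_arc[OF arcs_symmetric[OF a(1)]] d_arc[OF arcs_symmetric[OF a(2)]]
    d_sym[OF V(1,3)] d_sym[OF V(1,4)] d_sym[OF V(1,5)] d_sym[OF V(2,3)] d_sym[OF V(2,4)]
    d_sym[OF V(2,5)] d_sym[OF V(3,5)] d_sym[OF V(4,5)]
  \<comment> \<open>Along the line \<open>s (e\<^sub>x - e\<^sub>y - e\<^sub>u + e\<^sub>v) + (e\<^sub>z - e\<^sub>x)\<close> the form \<open>B\<close>
    is the nonconstant affine function \<open>d z x + 2 s\<close> of \<open>s\<close>; this \<open>s\<close> makes it negative.\<close>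
  define s :: real where "s = - real (d z x) - 1"
  define c where "c i = [s - 1, - s, - s, s, 1] ! i" for i
  define p where "p i = [x, y, u, v, z] ! i" for i
  let ?I = "{0, 1, 2, 3, 4 :: nat}"
  have "(\<Sum>i\<in>?I. \<Sum>j\<in>?I. c i * c j * real (d (p i) (p j))) \<le> 0"
  proof (rule conditionally_negative_definite)
    show "pos_semidef_on (pverts G) (\<lambda>x y. q ^ d x y)" if "0 < q" "q < 1" for q
      using psd that unfolding psd_params_def Q_matrix_def[abs_def] by auto
    show "p ` ?I \<subseteq> pverts G" using V by (simp add: p_def)
    show "sum c ?I = 0" by (simp add: c_def)
  qed simp
  also have "(\<Sum>i\<in>?I. \<Sum>j\<in>?I. c i * c j * real (d (p i) (p j))) = 2 * (- real (d z x) - 2 * s)"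
    by (simp add: c_def p_def dist algebra_simps)
  finally show False by (simp add: s_def)
qed

section \<open>The embedding by halfspaces\<close>

text \<open>The coordinates are the halfspaces that contain a base vertex \<open>b\<close>, one from
  each complementary pair, and \<open>x\<close> is sent to the set of those that separate it from
  \<open>b\<close>. An edge crosses exactly one of them, and a geodesic crosses none twice, so the
  distance of two vertices is the number of coordinates that separate them. Choosing an arc that
  defines each halfspace turns the coordinates into elements of \<^typ>\<open>'a \<times> 'a\<close>.\<close>

theorem halfspaces_determined_imp_hypercube_embeddable:
  assumes bip: "bipartite G" and det: halfspaces_determined and arc: "(b, b') \<in> parcs G"
  shows "hypercube_embeddable TYPE('a \<times> 'a) G"
proof -
  define H where "H = {closer G u v | u v. (u, v) \<in> parcs G \<and> b \<in> closer G u v}"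
  define sep where "sep x y = {A \<in> H. (x \<in> A) \<noteq> (y \<in> A)}" for x y
  have edge: "x \<in> closer G x y" "y \<notin> closer G x y" if "(x, y) \<in> parcs G" for x y
    using d_arc[OF that] wellformed'[OF that] by (auto simp: closer_iff)
  have b: "b \<in> pverts G" using wellformed'[OF arc] by blast
  have crossed: "closer G u v = closer G x y"
    if "(u, v) \<in> parcs G" "(x, y) \<in> parcs G" "x \<in> closer G u v" "y \<notin> closer G u v" for u v x y
    using det that not_closer_iff[OF bip that(1) wellformed'(2)[OF that(2)]]
    unfolding halfspaces_determined_def by blast
  have sep_edge: "\<exists>A. sep x y = {A} \<and> (A = closer G x y \<or> A = closer G y x)"
    if a: "(x, y) \<in> parcs G" for x y
  proof -
    note a' = arcs_symmetric[OF a]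
    define A where "A = (if b \<in> closer G x y then closer G x y else closer G y x)"
    have "A \<in> sep x y"
      using a a' edge[OF a] edge[OF a'] not_closer_iff[OF bip a b]
      unfolding A_def sep_def H_def by auto
    moreover have "B = A" if B_sep: "B \<in> sep x y" for B
    proof -
      obtain u v where B: "B = closer G u v" "(u, v) \<in> parcs G" "b \<in> B" "(x \<in> B) \<noteq> (y \<in> B)"
        using B_sep unfolding sep_def H_def by blast
      then have "B = closer G x y \<or> B = closer G y x"
        using crossed[OF B(2) a] crossed[OF B(2) a'] by blast
      then show "B = A" using B(3) not_closer_iff[OF bip a b] unfolding A_def by auto
    qed
    ultimately have "sep x y = {A}" by blast
    then show ?thesis unfolding A_def by auto
  qed
  have card_sep: "finite (sep x y) \<and> card (sep x y) = d x y"
    if "x \<in> pverts G" "y \<in> pverts G" for x y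
    using that
  proof (induction "d x y" arbitrary: x)
    case 0
    then have "x = y" using d_eq_0D by simp
    then show ?case using 0 by (simp add: sep_def)
  next
    case (Suc n)
    obtain w where w: "(x, w) \<in> parcs G" "d w y = n"
      using d_step[OF Suc.hyps(2)[symmetric] Suc.prems] by blast
    have wV: "w \<in> pverts G" using wellformed'[OF w(1)] by blast
    have IH: "finite (sep w y)" "card (sep w y) = n"
      using Suc.hyps(1)[of w] w wV Suc.prems by auto
    obtain A where A: "sep x w = {A}" "A = closer G x w \<or> A = closer G w x"
      using sep_edge[OF w(1)] by blast
    \<comment> \<open>The rest of the geodesic stays on the side of \<open>w\<close>, so it does not cross \<open>A\<close> again.\<close>
    have "y \<in> closer G w x"
      using Suc.hyps(2) w(2) Suc.prems d_sym[OF Suc.prems] d_sym[OF wV Suc.prems(2)]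
      by (simp add: closer_iff)
    then have "A \<notin> sep w y"
      using A(2) edge[OF w(1)] edge(1)[OF arcs_symmetric[OF w(1)]]
        not_closer_iff[OF bip w(1) Suc.prems(2)] unfolding sep_def by blast
    moreover have "B \<in> sep x y \<longleftrightarrow> (B \<in> sep x w) \<noteq> (B \<in> sep w y)" for B
      unfolding sep_def by blast
    ultimately have "sep x y = insert A (sep w y)" using A(1) by auto
    then show ?case using IH \<open>A \<notin> sep w y\<close> Suc.hyps(2) by simp
  qed
  define rep where "rep A = (SOME e. e \<in> parcs G \<and> A = closer G (fst e) (snd e))" for A
  have rep: "A = closer G (fst (rep A)) (snd (rep A))" if "A \<in> H" for A
  proof -
    have "\<exists>e. e \<in> parcs G \<and> A = closer G (fst e) (snd e)"
      using that unfolding H_def by force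
    from someI_ex[OF this] show ?thesis unfolding rep_def by blast
  qed
  have inj: "inj_on rep H" by (rule inj_onI) (metis rep)
  define h where "h x = rep ` sep b x" for x
  have sep_H: "sep x y \<subseteq> H" for x y by (auto simp: sep_def)
  have verts: "h x \<in> pverts (hypercube (rep ` H))" if "x \<in> pverts G" for x
    using card_sep[OF b that] sep_H by (auto simp: h_def hypercube_def)
  have "gdist (hypercube (rep ` H)) (h x) (h y) = d x y"
    if V: "x \<in> pverts G" "y \<in> pverts G" for x y
  proof -
    have "sym_diff (h x) (h y) = rep ` (sym_diff (sep b x) (sep b y))"
      unfolding h_def image_Un
      using inj_on_image_set_diff[OF inj] sep_H by (metis Diff_subset dual_order.trans)
    also have "sym_diff (sep b x) (sep b y) = sep x y"
      unfolding sep_def by blast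
    finally have "card (sym_diff (h x) (h y)) = card (sep x y)"
      using card_image[OF inj_on_subset[OF inj sep_H]] by simp
    then show ?thesis using gdist_hypercube[OF verts verts] card_sep V by simp
  qed
  then have "isometric_embedding h G (hypercube (rep ` H))"
    using verts unfolding isometric_embedding_def by blast
  moreover have "rep ` H \<noteq> {}"
    using arc edge(1)[OF arc] unfolding H_def by blast
  ultimately show ?thesis
    unfolding hypercube_embeddable_def by (intro exI[of _ "rep ` H"] exI[of _ h] conjI)
qed

lemma arc_exists:
  assumes "u \<in> pverts G" "v \<in> pverts G" "u \<noteq> v"
  obtains w where "(u, w) \<in> parcs G"
proof -
  have "d u v \<noteq> 0" using assms d_eq_0D by blast
  then obtain n where "d u v = Suc n" using not0_implies_Suc by blast
  with d_step[OF this assms(1,2)] that show thesis by blast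
qed

end

section \<open>The equivalence\<close>

theorem theorem3:
  fixes G :: "'a pair_pre_digraph"
  assumes "pair_bidirected_digraph G"
    and "Digraph_Component.connected (with_proj G)"
    and "\<exists>u\<in>pverts G. \<exists>v\<in>pverts G. u \<noteq> v"
  defines "i \<equiv> psd_params G = {-1..1}"
    and "ii \<equiv> hypercube_embeddable TYPE('a \<times> 'a) G"
    and "iii \<equiv> bipartite G \<and>
      \<not> (\<exists>x1\<in>pverts G. \<exists>x2\<in>pverts G. \<exists>x3\<in>pverts G. \<exists>x4\<in>pverts G. \<exists>x5\<in>pverts G.
          (x1, x2) \<in> parcs G \<and> (x3, x4) \<in> parcs G \<and>
          x3 \<in> closer G x1 x2 \<and> x4 \<in> closer G x2 x1 \<and>
          x5 \<in> closer G x1 x2 \<inter> closer G x4 x3)"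
    and "iv \<equiv> bipartite G \<and> (\<forall>(x, y)\<in>parcs G. geodesically_convex G (closer G x y))"
  shows "(i \<longleftrightarrow> ii) \<and> (ii \<longleftrightarrow> iii) \<and> (iii \<longleftrightarrow> iv)
    \<and> (hypercube_embeddable TYPE('b) G \<longrightarrow> ii)"
proof -
  interpret connected_bidirected_digraph G
    by (intro connected_bidirected_digraph.intro connected_bidirected_digraph_axioms.intro assms(1,2))
  obtain x y where arc: "(x, y) \<in> parcs G"
    using assms(3) arc_exists by metis
  have iii: "iii \<longleftrightarrow> bipartite G \<and> halfspaces_determined"
    unfolding iii_def using no_quintuple_iff by blast
  have iv: "iv \<longleftrightarrow> bipartite G \<and> halfspaces_determined"
    unfolding iv_def using convex_halfspaces_iff by blast
  have "ii \<Longrightarrow> i" "hypercube_embeddable TYPE('b) G \<Longrightarrow> i"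
    unfolding i_def ii_def using hypercube_embeddable_imp_psd_params arc by blast+
  moreover have "iii" if i
  proof -
    have psd: "psd_params G = {-1..1}" using that by (simp add: i_def)
    then have bip: "bipartite G" by (intro psd_minus_one_imp_bipartite) simp
    moreover have halfspaces_determined
      using psd by (intro psd_imp_halfspaces_determined[OF bip]) auto
    ultimately show iii using iii by blast
  qed
  moreover have "iii \<Longrightarrow> ii"
    unfolding iii ii_def using halfspaces_determined_imp_hypercube_embeddable arc by blast
  ultimately show ?thesis using iii iv by blast
qed

end
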